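(* We have $P(1)=3$, and, up to similarity, the set of three vertices of an equilateral triangle is the unique optimal configuration for $k=1$.
   Context: For a set $\mathcal{P} \subset \mathbb{R}^2$, let $A(\mathcal{P})$ be the number of distinct values in the open interval $(0,\pi)$ taken by the angle magnitudes $|\angle abc|$ (the angle at $b$ between the rays from $b$ through $a$ and from $b$ through $c$, measured in $[0,\pi]$), where $a,b,c$ range over triples of distinct points of $\mathcal{P}$. In particular, angles equal to $0$ or $\pi$ are not counted. For an integer $k\ge 1$, define $$P(k) := \max\{\#\mathcal{P} : \mathcal{P}\subseteq \mathbb{R}^2,\ \text{not all points of } \mathcal{P} \text{ are collinear},\ A(\mathcal{P}) \leq k\}.$$ An optimal (maximal) configuration for $k$ is a set $\mathcal{P}\subseteq\mathbb{R}^2$, not all of whose points are collinear, with $A(\mathcal{P})\le k$ and $\#\mathcal{P}=P(k)$. Configurations are considered up to similarity, i.e. up to rigid motions (including reflections) and dilations of the plane. *)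

theory Defs
  imports "HOL-Analysis.Analysis" "HOL-Library.Extended_Nat"
begin

(* HOL's card sends infinite sets to 0, so cardinalities are counted in enat. *)
definition ecard :: "'a set \<Rightarrow> enat" where
  "ecard S = (if finite S then enat (card S) else \<infinity>)"

definition angle :: "real^2 \<Rightarrow> real^2 \<Rightarrow> real^2 \<Rightarrow> real" where
  "angle a b c = arccos (((a - b) \<bullet> (c - b)) / (norm (a - b) * norm (c - b)))"

definition angles :: "(real^2) set \<Rightarrow> real set" where
  "angles S = {\<theta>. 0 < \<theta> \<and> \<theta> < pi \<and>
     (\<exists>a\<in>S. \<exists>b\<in>S. \<exists>c\<in>S. a \<noteq> b \<and> b \<noteq> c \<and> a \<noteq> c \<and> \<theta> = angle a b c)}"

definition num_angles :: "(real^2) set \<Rightarrow> enat" where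
  "num_angles S = ecard (angles S)"

definition admissible :: "nat \<Rightarrow> (real^2) set \<Rightarrow> bool" where
  "admissible k S \<longleftrightarrow> \<not> collinear S \<and> num_angles S \<le> enat k"

(* Sup on enat is total. In enat a supremum that is finite and nonzero is attained,
   so an equation max_points k = enat n with n > 0 says that n is the maximum. *)
definition max_points :: "nat \<Rightarrow> enat" where
  "max_points k = Sup (ecard ` {S. admissible k S})"

definition optimal :: "nat \<Rightarrow> (real^2) set \<Rightarrow> bool" where
  "optimal k S \<longleftrightarrow> admissible k S \<and> ecard S = max_points k"

(* An orthogonal transformation may have determinant -1, so reflections are included. *)
definition similar :: "(real^2) set \<Rightarrow> (real^2) set \<Rightarrow> bool" where
  "similar S T \<longleftrightarrow> (\<exists>r f v. r > 0 \<and> orthogonal_transformation f \<and>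
     T = (\<lambda>x. r *\<^sub>R f x + v) ` S)"

definition equilateral_triangle :: "(real^2) set \<Rightarrow> bool" where
  "equilateral_triangle S \<longleftrightarrow> (\<exists>a b c. S = {a, b, c} \<and> a \<noteq> b \<and>
     dist a b = dist b c \<and> dist b c = dist c a)"

end

theory Submission
  imports Defs
begin

text \<open>
  Any three non-collinear points of an admissible set for \<open>k = 1\<close> span a triangle whose three
  angles all lie in \<open>(0,\<pi>)\<close>, hence coincide; equal angles face equal sides, so the triangle is
  equilateral (\<open>admissible_1_imp_equidistant\<close>). An admissible set contains such a triangle
  \<open>abc\<close>. A fourth point \<open>d\<close> lies on at most one of the three side lines, because two of
  these lines meet only in a vertex. So \<open>d\<close> spans a proper, hence equilateral, triangle with
  each of two sides, and these two sides already involve all three vertices: the four points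
  are pairwise at the same distance, which is impossible in the plane
  (\<open>no_four_equidistant_points\<close>).

  Conversely every angle in an equilateral triangle is \<open>arccos (1/2)\<close>, so the
  equilateral triangles are exactly the admissible sets. All of them have three points,
  which makes all of them optimal. They form one similarity class: after scaling to the same size
  and translating one vertex onto its target, a reflection moves a second vertex onto its target,
  and the third vertex is brought onto its target by a second reflection, whose mirror contains
  the side already placed (\<open>equilateral_triangles_similar\<close>).
\<close>

section \<open>Angles and sides of a triangle\<close>

lemma angle_argument_bounded:
  "\<bar>((a - b) \<bullet> (c - b)) / (norm (a - b) * norm (c - b))\<bar> \<le> 1"
  using Cauchy_Schwarz_ineq2[of "a - b" "c - b"]
  by (cases "norm (a - b) * norm (c - b) = 0") (auto simp: abs_mult divide_le_eq_1)

lemma angle_in_open_interval: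
  assumes "\<not> collinear {a, b, c}"
  shows "0 < angle a b c" "angle a b c < pi"
proof -
  let ?q = "((a - b) \<bullet> (c - b)) / (norm (a - b) * norm (c - b))"
  have nz: "norm (a - b) * norm (c - b) \<noteq> 0"
    using assms by (auto simp: insert_commute)
  \<comment> \<open>Equality in the Cauchy--Schwarz inequality would mean collinearity.\<close>
  have "\<bar>(a - b) \<bullet> (c - b)\<bar> \<noteq> norm (a - b) * norm (c - b)"
    using assms unfolding norm_cauchy_schwarz_equal by (subst (asm) collinear_3) auto
  then have "\<bar>?q\<bar> \<noteq> 1"
    using nz by (auto simp: abs_mult)
  then have "-1 < ?q" "?q < 1"
    using angle_argument_bounded[of a b c] by linarith+
  then show "0 < angle a b c" "angle a b c < pi"
    unfolding angle_def using arccos_lt_bounded by blast+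
qed

text \<open>
  With side lengths \<open>x, y, z\<close>, the law of cosines turns the equality of the base angles into
  \<open>(x - y) * (z + x + y) * (z - (x + y)) = 0\<close>, and the last factor is nonzero by the strict
  triangle inequality.
\<close>

lemma equal_angles_imp_equal_sides:
  assumes nc: "\<not> collinear {a, b, c}" and eq: "angle c a b = angle c b a"
  shows "dist b c = dist c a"
proof -
  define x y z where "x = norm (c - b)" and "y = norm (c - a)" and "z = norm (a - b)"
  have ne: "a \<noteq> b" "b \<noteq> c" "c \<noteq> a" using nc by (auto simp: insert_commute)
  then have pos: "x > 0" "y > 0" "z > 0" by (auto simp: x_def y_def z_def)
  have "\<not> between (a, b) c"
    using nc between_imp_collinear[of a b c] by (auto simp: insert_commute)
  then have z: "z \<noteq> x + y"
    by (auto simp: between x_def y_def z_def dist_norm norm_minus_commute)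
  have A: "(c - a) \<bullet> (b - a) = (y\<^sup>2 + z\<^sup>2 - x\<^sup>2) / 2"
    by (simp add: dot_norm_neg x_def y_def z_def norm_minus_commute)
  have B: "(c - b) \<bullet> (a - b) = (x\<^sup>2 + z\<^sup>2 - y\<^sup>2) / 2"
    by (simp add: dot_norm_neg x_def y_def z_def norm_minus_commute)
  have "((c - a) \<bullet> (b - a)) / (norm (c - a) * norm (b - a))
      = ((c - b) \<bullet> (a - b)) / (norm (c - b) * norm (a - b))"
    using eq unfolding angle_def
    by (subst (asm) arccos_eq_iff) (use angle_argument_bounded in auto)
  then have "((y\<^sup>2 + z\<^sup>2 - x\<^sup>2) / 2) / (y * z) = ((x\<^sup>2 + z\<^sup>2 - y\<^sup>2) / 2) / (x * z)"
    unfolding A B by (simp add: x_def y_def z_def norm_minus_commute)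
  moreover have "x * p = y * q" if "(p / 2) / (y * z) = (q / 2) / (x * z)" for p q
    using that pos by (simp add: field_simps)
  ultimately have "x * (y\<^sup>2 + z\<^sup>2 - x\<^sup>2) = y * (x\<^sup>2 + z\<^sup>2 - y\<^sup>2)"
    by blast
  then have "(x - y) * ((z + x + y) * (z - (x + y))) = 0"
    by (simp add: algebra_simps power2_eq_square)
  then have "x = y" using z pos by simp
  then show ?thesis by (simp add: x_def y_def dist_norm norm_minus_commute)
qed

lemma equidistant_imp_not_collinear:
  fixes a b c :: "'a::euclidean_space"
  assumes "a \<noteq> b" "dist a b = dist b c" "dist b c = dist c a"
  shows "\<not> collinear {a, b, c}"
  using assms by (auto simp: collinear_between_cases between dist_commute)

lemma equidistant_angle:
  assumes "a \<noteq> b" "dist a b = dist b c" "dist b c = dist c a"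
  shows "angle a b c = arccos (1/2)"
proof -
  define s where "s = dist a b"
  have s: "norm (a - b) = s" "norm (c - b) = s" "norm (a - c) = s"
    using assms by (auto simp: s_def dist_norm norm_minus_commute)
  have "s \<noteq> 0" using assms(1) by (simp add: s_def)
  then show ?thesis
    by (simp add: angle_def dot_norm_neg s power2_eq_square)
qed

text \<open>
  The case \<open>n = 2\<close> of the fact that \<open>n\<close>-space has at most \<open>n + 1\<close> equidistant points. From
  \<open>a\<close>, the vector to \<open>d\<close> and the sum of the vectors to \<open>b\<close> and \<open>c\<close> are both orthogonal to
  \<open>c - b\<close>, hence parallel in the plane; but for side length \<open>s\<close> their
  squared lengths are \<open>s\<^sup>2\<close> and \<open>3 * s\<^sup>2\<close> while their inner product is \<open>s\<^sup>2\<close>.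
\<close>

lemma no_four_equidistant_points:
  fixes a b c d :: "real^2"
  assumes s: "s > 0"
    and abc: "dist a b = s" "dist b c = s" "dist c a = s"
    and d: "dist a d = s" "dist b d = s" "dist c d = s"
  shows False
proof -
  define u v w where "u = b - a" and "v = c - a" and "w = d - a"
  have sq: "x \<bullet> x = s\<^sup>2" if "norm x = s" for x :: "real^2"
    using that by (simp add: dot_square_norm)
  have "norm u = s" "norm v = s" "norm w = s"
    using abc d by (simp_all add: u_def v_def w_def dist_norm norm_minus_commute)
  then have uu: "u \<bullet> u = s\<^sup>2" "v \<bullet> v = s\<^sup>2" "w \<bullet> w = s\<^sup>2"
    by (simp_all only: sq)
  have "norm (u - v) = s" "norm (u - w) = s" "norm (v - w) = s"
    using abc d by (auto simp: u_def v_def w_def dist_norm norm_minus_commute)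
  then have "(u - v) \<bullet> (u - v) = s\<^sup>2" "(u - w) \<bullet> (u - w) = s\<^sup>2" "(v - w) \<bullet> (v - w) = s\<^sup>2"
    by (simp_all only: sq)
  then have uv: "2 * (u \<bullet> v) = s\<^sup>2" "2 * (u \<bullet> w) = s\<^sup>2" "2 * (v \<bullet> w) = s\<^sup>2"
    using uu by (auto simp: inner_diff inner_commute)
  define m q where "m = u + v" and "q = v - u"
  have mq: "m \<bullet> q = 0" "w \<bullet> q = 0" and qq: "q \<bullet> q = s\<^sup>2"
    and mm: "m \<bullet> m = 3 * s\<^sup>2" and mw: "m \<bullet> w = s\<^sup>2"
    using uu uv by (auto simp: m_def q_def inner_add inner_diff inner_commute)
  let ?det = "m$1 * w$2 - m$2 * w$1"
  have "?det * q$1 = 0" "?det * q$2 = 0"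
    using mq unfolding inner_vec_def sum_2 inner_real_def by algebra+
  moreover have "q \<noteq> 0" using qq s by auto
  then have "q$1 \<noteq> 0 \<or> q$2 \<noteq> 0" by (auto simp: vec_eq_iff forall_2)
  ultimately have "?det = 0" by auto
  \<comment> \<open>Lagrange's identity: parallel vectors attain equality in the Cauchy--Schwarz inequality.\<close>
  moreover have "(m \<bullet> w)\<^sup>2 + ?det\<^sup>2 = (m \<bullet> m) * (w \<bullet> w)"
    unfolding inner_vec_def sum_2 inner_real_def by algebra
  ultimately have "s\<^sup>2 * s\<^sup>2 = 3 * (s\<^sup>2 * s\<^sup>2)"
    using mm mw uu by (simp add: power2_eq_square)
  then show False using s by simp
qed

section \<open>Admissible sets for one angle\<close>

lemma ecard_le_1_iff: "ecard A \<le> enat 1 \<longleftrightarrow> (\<forall>x\<in>A. \<forall>y\<in>A. x = y)"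
proof
  assume "ecard A \<le> enat 1"
  then have "finite A" "card A \<le> 1" by (auto simp: ecard_def split: if_splits)
  then show "\<forall>x\<in>A. \<forall>y\<in>A. x = y" by (simp add: card_le_Suc0_iff_eq)
next
  assume *: "\<forall>x\<in>A. \<forall>y\<in>A. x = y"
  then have "finite A"
    by (metis finite.simps finite_subset singletonI subsetI)
  with * show "ecard A \<le> enat 1" by (simp add: ecard_def card_le_Suc0_iff_eq)
qed

lemma admissible_1_imp_equidistant:
  assumes S: "admissible 1 S" and abc: "a \<in> S" "b \<in> S" "c \<in> S" and nc: "\<not> collinear {a, b, c}"
  shows "dist a b = dist b c" "dist b c = dist c a"
proof -
  have uniq: "\<theta> = \<phi>" if "\<theta> \<in> angles S" "\<phi> \<in> angles S" for \<theta> \<phi>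
    using S that unfolding admissible_def num_angles_def ecard_le_1_iff by blast
  have in_angles: "angle x y z \<in> angles S" if "{x, y, z} = {a, b, c}" for x y z
  proof -
    have nc': "\<not> collinear {x, y, z}" using nc that by simp
    then have "x \<noteq> y" "y \<noteq> z" "x \<noteq> z" by (auto simp: insert_commute)
    moreover have "{x, y, z} \<subseteq> S" using that abc by simp
    ultimately show ?thesis
      using angle_in_open_interval[OF nc'] by (auto simp: angles_def)
  qed
  show "dist b c = dist c a"
    by (intro equal_angles_imp_equal_sides nc uniq in_angles) auto
  have "\<not> collinear {c, a, b}" using nc by (simp add: insert_commute)
  then show "dist a b = dist b c"
    by (intro equal_angles_imp_equal_sides uniq in_angles) auto
qed

text \<open>
  The equilateral triangles \<open>abd\<close> and \<open>bcd\<close> share the side \<open>bd\<close>, which forces all six distances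
  between the four points to be equal.
\<close>

lemma admissible_1_no_fourth_point:
  assumes S: "admissible 1 S" and abc: "a \<in> S" "b \<in> S" "c \<in> S" and nc: "\<not> collinear {a, b, c}"
    and d: "d \<in> S" and abd: "\<not> collinear {a, b, d}" and bcd: "\<not> collinear {b, c, d}"
  shows False
proof (rule no_four_equidistant_points)
  show "dist a b > 0" using nc by auto
  show "dist a b = dist a b" ..
  note D = admissible_1_imp_equidistant[OF S]
  show "dist b c = dist a b" "dist c a = dist a b"
    using D[of a b c] abc nc by auto
  show "dist a d = dist a b" "dist b d = dist a b"
    using D[of a b d] abc d abd by (auto simp: dist_commute)
  then show "dist c d = dist a b"
    using D[of b c d] abc d bcd by (auto simp: dist_commute)
qed

lemma not_collinear_obtains_triple:
  fixes S :: "'a::euclidean_space set"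
  assumes "\<not> collinear S"
  obtains a b c where "a \<in> S" "b \<in> S" "c \<in> S" "\<not> collinear {a, b, c}"
proof -
  obtain a where a: "a \<in> S" using assms by (metis collinear_empty ex_in_conv)
  have "S \<noteq> {a}" using assms by auto
  then obtain b where b: "b \<in> S" "a \<noteq> b" using a by blast
  have "insert a (insert b S) = S" using a b by auto
  then show thesis using that a b assms collinear_triples[of a b S] by metis
qed

lemma admissible_1_imp_equilateral_triangle:
  assumes S: "admissible 1 S"
  shows "equilateral_triangle S"
proof -
  obtain a b c where abc: "a \<in> S" "b \<in> S" "c \<in> S" and nc: "\<not> collinear {a, b, c}"
    using S not_collinear_obtains_triple unfolding admissible_def by metis
  have ne: "a \<noteq> b" "b \<noteq> c" "c \<noteq> a" using nc by (auto simp: insert_commute)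
  have "d \<in> {a, b, c}" if d: "d \<in> S" for d
  proof (rule ccontr)
    assume nd: "d \<notin> {a, b, c}"
    \<comment> \<open>Otherwise \<open>y\<close> and \<open>d\<close> are two common points of the lines \<open>xy\<close> and \<open>yz\<close>.\<close>
    have two_lines: "\<not> collinear {x, y, d} \<or> \<not> collinear {y, z, d}"
      if "{x, y, z} = {a, b, c}" for x y z
    proof (rule ccontr)
      assume *: "\<not> ?thesis"
      have "y \<noteq> d" using that nd by auto
      then have "collinear {x, y, z}"
        using * collinear_3_trans[of x d y z] collinear_3_trans[of x y d z]
        by (auto simp: insert_commute)
      with nc that show False by simp
    qed
    have "\<not> collinear {a, b, d} \<or> \<not> collinear {b, c, d}"
      "\<not> collinear {b, c, d} \<or> \<not> collinear {c, a, d}"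
      "\<not> collinear {c, a, d} \<or> \<not> collinear {a, b, d}"
      by (intro two_lines; auto)+
    then consider "\<not> collinear {a, b, d}" "\<not> collinear {b, c, d}"
      | "\<not> collinear {b, c, d}" "\<not> collinear {c, a, d}"
      | "\<not> collinear {c, a, d}" "\<not> collinear {a, b, d}"
      by blast
    then show False
    proof cases
      case 1 then show ?thesis using admissible_1_no_fourth_point[OF S abc nc d] by blast
    next
      case 2 then show ?thesis
        using admissible_1_no_fourth_point[OF S abc(2,3,1) _ d] nc by (auto simp: insert_commute)
    next
      case 3 then show ?thesis
        using admissible_1_no_fourth_point[OF S abc(3,1,2) _ d] nc by (auto simp: insert_commute)
    qed
  qed
  then have "S = {a, b, c}" using abc by auto
  then show ?thesis
    unfolding equilateral_triangle_def
    using ne admissible_1_imp_equidistant[OF S abc nc] by blast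
qed

lemma equilateral_triangle_imp_admissible_1:
  assumes "equilateral_triangle S"
  shows "admissible 1 S"
proof -
  obtain a b c where S: "S = {a, b, c}" and abc: "a \<noteq> b" "dist a b = dist b c" "dist b c = dist c a"
    using assms unfolding equilateral_triangle_def by blast
  have side: "dist x y = dist a b" if "x \<in> S" "y \<in> S" "x \<noteq> y" for x y
    using that abc unfolding S by (auto simp: dist_commute)
  have "\<theta> = arccos (1/2)" if \<theta>: "\<theta> \<in> angles S" for \<theta>
  proof -
    obtain x y z where xyz: "x \<in> S" "y \<in> S" "z \<in> S" "x \<noteq> y" "y \<noteq> z" "x \<noteq> z"
      and "\<theta> = angle x y z"
      using \<theta> unfolding angles_def by blast
    moreover have "angle x y z = arccos (1/2)"
      using xyz side by (intro equidistant_angle) auto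
    ultimately show ?thesis by simp
  qed
  then have "num_angles S \<le> enat 1"
    unfolding num_angles_def ecard_le_1_iff by metis
  then show ?thesis
    using equidistant_imp_not_collinear[OF abc] by (simp add: admissible_def S)
qed

lemma ecard_equilateral_triangle:
  assumes "equilateral_triangle S"
  shows "ecard S = 3"
proof -
  obtain a b c where S: "S = {a, b, c}" and abc: "a \<noteq> b" "dist a b = dist b c" "dist b c = dist c a"
    using assms unfolding equilateral_triangle_def by blast
  then have "b \<noteq> c" "c \<noteq> a" by (metis dist_eq_0_iff)+
  then have "card S = 3" using S abc(1) by auto
  then show ?thesis by (simp add: ecard_def S numeral_eq_enat)
qed

lemma equilateral_triangle_exists: "\<exists>T. equilateral_triangle T"
proof -
  let ?a = "vector [0, 0] :: real^2" and ?b = "vector [2, 0] :: real^2"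
    and ?c = "vector [1, sqrt 3] :: real^2"
  have "equilateral_triangle {?a, ?b, ?c}"
    unfolding equilateral_triangle_def
    by (intro exI[of _ ?a] exI[of _ ?b] exI[of _ ?c])
      (simp add: vec_eq_iff forall_2 dist_vec_def L2_set_def sum_2 dist_real_def)
  then show ?thesis by blast
qed

section \<open>Similarity of equilateral triangles\<close>

text \<open>
  The map is the reflection in the perpendicular bisector of \<open>a\<close> and \<open>b\<close>. For \<open>a = b\<close> the
  formula divides by zero and gives the identity, as it should.
\<close>

lemma reflection_exchanging:
  fixes a b :: "'a::real_inner"
  assumes ab: "norm a = norm b"
  obtains f where "orthogonal_transformation f" "f a = b"
    "\<And>x. x \<bullet> a = x \<bullet> b \<Longrightarrow> f x = x"
proof
  define p where "p = a - b"
  let ?f = "\<lambda>x. x - (2 * (x \<bullet> p) / (p \<bullet> p)) *\<^sub>R p"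
  have "?f x \<bullet> ?f y = x \<bullet> y" for x y
    by (cases "p = 0") (simp_all add: inner_diff inner_commute)
  moreover have "linear ?f"
    by (rule linearI) (simp_all add: inner_add add_divide_distrib algebra_simps)
  ultimately show "orthogonal_transformation ?f"
    by (simp add: orthogonal_transformation_def)
  have "a \<bullet> a = b \<bullet> b" using ab by (simp add: dot_square_norm)
  then have "2 * (a \<bullet> p) = p \<bullet> p" by (simp add: p_def inner_diff inner_commute)
  then show "?f a = b" by (cases "p = 0") (auto simp: p_def)
  show "?f x = x" if "x \<bullet> a = x \<bullet> b" for x
    using that by (simp add: p_def inner_diff_right)
qed

lemma orthogonal_transformation_pair:
  fixes u v u' v' :: "'a::real_inner"
  assumes "norm u = norm u'" "norm v = norm v'" "u \<bullet> v = u' \<bullet> v'"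
  obtains f where "orthogonal_transformation f" "f u = u'" "f v = v'"
proof -
  obtain f where f: "orthogonal_transformation f" "f u = u'"
    using reflection_exchanging[OF assms(1)] by metis
  have "norm (f v) = norm v'" using assms f by (simp add: orthogonal_transformation_norm)
  then obtain g where g: "orthogonal_transformation g" "g (f v) = v'"
    and fix_g: "\<And>x. x \<bullet> f v = x \<bullet> v' \<Longrightarrow> g x = x"
    using reflection_exchanging by metis
  \<comment> \<open>The second mirror contains \<open>u'\<close>, so the first vector stays in place.\<close>
  have "u' \<bullet> f v = u' \<bullet> v'"
    using f assms(3) by (metis orthogonal_transformation_def)
  then have "g (f u) = u'" using f fix_g by simp
  then show thesis
    using that[of "g \<circ> f"] orthogonal_transformation_compose g f by (metis comp_apply)
qed

lemma equilateral_triangles_similar: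
  assumes "equilateral_triangle T" "equilateral_triangle S"
  shows "similar T S"
proof -
  obtain a b c where T: "T = {a, b, c}" and abc: "a \<noteq> b" "dist a b = dist b c" "dist b c = dist c a"
    using assms(1) unfolding equilateral_triangle_def by blast
  obtain a' b' c' where S: "S = {a', b', c'}"
    and abc': "a' \<noteq> b'" "dist a' b' = dist b' c'" "dist b' c' = dist c' a'"
    using assms(2) unfolding equilateral_triangle_def by blast
  define r where "r = dist a' b' / dist a b"
  have r: "r > 0" using abc(1) abc'(1) by (simp add: r_def)
  have "c \<noteq> a" using abc by (metis dist_eq_0_iff)
  then have side: "r * norm (b - a) = norm (b' - a')" "r * norm (c - a) = norm (c' - a')"
    "r * norm ((b - a) - (c - a)) = norm ((b' - a') - (c' - a'))"
    using abc abc' by (simp_all add: r_def dist_norm norm_minus_commute)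
  have "(r *\<^sub>R (b - a)) \<bullet> (r *\<^sub>R (c - a)) = (b' - a') \<bullet> (c' - a')"
    unfolding dot_norm_neg using side r
    by (simp add: norm_scaleR flip: scaleR_diff_right)
  moreover have "norm (r *\<^sub>R (b - a)) = norm (b' - a')" "norm (r *\<^sub>R (c - a)) = norm (c' - a')"
    using side r by auto
  ultimately obtain f where f: "orthogonal_transformation f"
    and fb: "f (r *\<^sub>R (b - a)) = b' - a'" and fc: "f (r *\<^sub>R (c - a)) = c' - a'"
    using orthogonal_transformation_pair by metis
  have lin: "linear f" using f by (rule orthogonal_transformation_linear)
  have eqs: "r *\<^sub>R f b = r *\<^sub>R f a + (b' - a')" "r *\<^sub>R f c = r *\<^sub>R f a + (c' - a')"
    using fb fc by (simp_all add: linear_diff[OF lin] linear_scale[OF lin] algebra_simps)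
  have "S = (\<lambda>x. r *\<^sub>R f x + (a' - r *\<^sub>R f a)) ` T"
    by (simp add: S T eqs)
  then show ?thesis unfolding similar_def using r f by blast
qed

lemma equilateral_triangle_similar_image:
  assumes "equilateral_triangle T" "similar T S"
  shows "equilateral_triangle S"
proof -
  obtain a b c where T: "T = {a, b, c}" and abc: "a \<noteq> b" "dist a b = dist b c" "dist b c = dist c a"
    using assms(1) unfolding equilateral_triangle_def by blast
  obtain r f v where r: "r > 0" and f: "orthogonal_transformation f"
    and S: "S = (\<lambda>x. r *\<^sub>R f x + v) ` T"
    using assms(2) unfolding similar_def by blast
  let ?g = "\<lambda>x. r *\<^sub>R f x + v"
  have dist: "dist (?g x) (?g y) = r * dist x y" for x y
  proof -
    have "dist (?g x) (?g y) = norm (r *\<^sub>R f (x - y))"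
      by (simp add: dist_norm linear_diff[OF orthogonal_transformation_linear[OF f]] scaleR_diff_right)
    also have "\<dots> = r * dist x y"
      using r by (simp add: orthogonal_transformation_norm[OF f] dist_norm)
    finally show ?thesis .
  qed
  have "dist (?g a) (?g b) \<noteq> 0" using dist[of a b] r abc(1) by simp
  then have "?g a \<noteq> ?g b" by (metis dist_self)
  moreover have "S = {?g a, ?g b, ?g c}" by (simp add: S T)
  ultimately show ?thesis
    unfolding equilateral_triangle_def using dist abc by metis
qed

section \<open>The optimal configurations\<close>

theorem proposition1p4:
  shows "max_points 1 = 3 \<and>
    (\<exists>T. equilateral_triangle T) \<and>
    (\<forall>T S. equilateral_triangle T \<longrightarrow> (optimal 1 S \<longleftrightarrow> similar T S))"
proof -
  have adm: "admissible 1 S \<longleftrightarrow> equilateral_triangle S" for S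
    using admissible_1_imp_equilateral_triangle equilateral_triangle_imp_admissible_1 by blast
  have "ecard ` {S. admissible 1 S} = {3}"
    using adm ecard_equilateral_triangle equilateral_triangle_exists by auto
  then have max: "max_points 1 = 3" by (simp add: max_points_def)
  then have "optimal 1 S \<longleftrightarrow> equilateral_triangle S" for S
    using adm ecard_equilateral_triangle by (auto simp: optimal_def)
  then show ?thesis
    using max equilateral_triangle_exists equilateral_triangles_similar
      equilateral_triangle_similar_image by blast
qed

end
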